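(* Let $A$, $b$ and $\beta=1-\|a\|_{W}$ be as in the context, and suppose $$0<\tau\le\min\Big\{2,\ \frac{\beta}{\|A^{-1}b\|_1},\ \frac{\beta}{\beta-\|(A-\beta I)^{-1}b\|_1}\Big\}.$$ Then, for any $\mu_0\in[0,\beta]$, the sequence $\{\mu_k\}_{k\ge0}$ generated by $$x_{k+1}=(A-\mu_kI)^{-1}b,\qquad \mu_{k+1}=\tau\|x_{k+1}\|_1+(1-\tau)\mu_k$$ converges to a constant $\mu_*\in[0,\beta]$.
   Context: Let $n\ge 1$, let $a(z)=\sum_{i=1-n}^{n-1}a_iz^i$ have real coefficients, $T_n(a)$ the $n\times n$ Toeplitz matrix with $(T_n(a))_{i,j}=a_{j-i}$, and $\|a\|_{W}:=\sum_{i=1-n}^{n-1}|a_i|$. Set $A=(2-\|a\|_{W})I-T_n(a)$, $\beta=1-\|a\|_{W}$, and let $b\in\mathbb R^n$ be nonnegative and nonzero. Standing assumptions: $T_n(a)\ge 0$ (entrywise), $\|a\|_{W}+\|b\|_1<1$ and $\|b\|_1<(1-\|a\|_{W})^2$. Under these assumptions $A-\mu I$ is an invertible M-matrix for $\mu\in[0,\beta]$, and $\beta-\|(A-\beta I)^{-1}b\|_1>0$. $\|\cdot\|_1$ is the vector 1-norm. *)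

theory Defs
  imports Complex_Main "Jordan_Normal_Form.Gauss_Jordan_Elimination"
begin

(* A Laurent polynomial a(z) = sum of a_i z^i over 1-n <= i <= n-1 is given by its coefficients
   i |-> a_i; values of the coefficient function outside that range are never used. *)

definition toeplitz :: "nat \<Rightarrow> (int \<Rightarrow> real) \<Rightarrow> real mat" where
  "toeplitz n a = mat n n (\<lambda>(i, j). a (int j - int i))"

definition wiener_norm :: "nat \<Rightarrow> (int \<Rightarrow> real) \<Rightarrow> real" where
  "wiener_norm n a = (\<Sum>i = 1 - int n..int n - 1. \<bar>a i\<bar>)"

definition vec_norm1 :: "real vec \<Rightarrow> real" where
  "vec_norm1 v = (\<Sum>i<dim_vec v. \<bar>v $ i\<bar>)"

(* Unspecified for singular matrices, where mat_inverse returns None. *)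

definition mat_inv :: "real mat \<Rightarrow> real mat" where
  "mat_inv M = the (mat_inverse M)"

end

theory Submission
  imports Defs "Jordan_Normal_Form.Determinant" "HOL-Analysis.Elementary_Metric_Spaces"
begin

text \<open>
  Put \<open>T = toeplitz n a\<close>, \<open>w = wiener_norm n a\<close> and \<open>B = vec_norm1 b\<close>.  For \<open>\<mu> \<in> [0,\<beta>]\<close> the
  matrix \<open>A - \<mu> I\<close> equals \<open>s I - T\<close> with \<open>s = 1 + \<beta> - \<mu>\<close>, and \<open>s - w = 2\<beta> - \<mu> \<ge> \<beta> > 0\<close>.
  Every column of the nonnegative matrix \<open>T\<close> sums to at most \<open>w\<close>, so, as \<open>w < s\<close>, a solution of
  \<open>(s I - T) x = b\<close> with \<open>b \<ge> 0\<close> is nonnegative (\<open>solution_nonneg\<close>), and summing its equations gives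
  \<open>(s - w) \<parallel>x\<parallel> \<le> \<parallel>b\<parallel> \<le> s \<parallel>x\<parallel>\<close> in the 1-norm (\<open>solution_sum_bounds\<close>).  Let \<open>F \<mu>\<close> be the 1-norm of the
  solution.

  The difference of the solutions for two shifts solves an equation of the same kind, whose
  right-hand side is a multiple of one of the solutions (the resolvent identity).  The same bounds
  therefore control the difference (\<open>solution_difference_bounds\<close>), and every secant slope of \<open>F\<close>
  on \<open>[0,\<beta>]\<close> lies between \<open>B / 4 > 0\<close> and \<open>B / \<beta>\<^sup>2 < 1\<close>.  Since \<open>0 < \<tau> \<le> 2\<close>, the
  secant slopes \<open>1 - \<tau> + \<tau> q\<close> of the relaxed map \<open>g = \<tau> F + (1 - \<tau>) id\<close> stay in a compact
  part of \<open>(-1, 1)\<close>, so \<open>g\<close> is a contraction (\<open>relaxed_map_contraction\<close>).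

  It remains to see that \<open>g\<close> maps \<open>[0,\<beta>]\<close> into itself.  The upper bound follows from
  \<open>F \<mu> \<le> \<beta>\<^sup>2 / (2\<beta> - \<mu>)\<close> and \<open>\<tau> \<le> 2\<close>.  The lower bound is clear for \<open>\<tau> \<le> 1\<close>.  For
  \<open>\<tau> > 1\<close>, the slope estimate with right end point \<open>\<beta>\<close> gives \<open>\<beta> F \<beta> \<le> (2\<beta> - \<mu>) F \<mu>\<close>; with \<open>\<mu> (2\<beta> - \<mu>) \<le> \<beta>\<^sup>2\<close> this reduces \<open>g \<mu> \<ge> 0\<close>
  to \<open>g \<beta> \<ge> 0\<close>, which is the hypothesis \<open>\<tau> \<le> \<beta> / (\<beta> - F \<beta>)\<close>.  The contraction principle on
  \<open>[0,\<beta>]\<close> then gives convergence to the unique fixed point.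
\<close>

section \<open>Shifted nonnegative matrices with bounded column sums\<close>

locale column_bounded =
  fixes n :: nat and T :: "nat \<Rightarrow> nat \<Rightarrow> real" and w :: real
  assumes entry_nonneg: "\<And>i j. i < n \<Longrightarrow> j < n \<Longrightarrow> 0 \<le> T i j"
    and column_sum_le: "\<And>j. j < n \<Longrightarrow> (\<Sum>i<n. T i j) \<le> w"
begin

definition solves :: "real \<Rightarrow> (nat \<Rightarrow> real) \<Rightarrow> (nat \<Rightarrow> real) \<Rightarrow> bool" where
  "solves s x b \<longleftrightarrow> (\<forall>i<n. s * x i = (\<Sum>j<n. T i j * x j) + b i)"

lemma sum_image_le:
  assumes "\<And>j. j < n \<Longrightarrow> 0 \<le> v j"
  shows "(\<Sum>i<n. \<Sum>j<n. T i j * v j) \<le> w * (\<Sum>j<n. v j)"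
proof -
  have "(\<Sum>i<n. \<Sum>j<n. T i j * v j) = (\<Sum>j<n. (\<Sum>i<n. T i j) * v j)"
    by (subst sum.swap) (simp add: sum_distrib_right)
  also have "\<dots> \<le> (\<Sum>j<n. w * v j)"
    by (intro sum_mono mult_right_mono) (auto simp: column_sum_le assms)
  finally show ?thesis by (simp add: sum_distrib_left)
qed

text \<open>
  The negative part of a solution satisfies \<open>s x\<^sup>- \<le> T x\<^sup>-\<close> entrywise.  Summing this gives
  \<open>s \<Sum>x\<^sup>- \<le> w \<Sum>x\<^sup>-\<close>, which forces \<open>x\<^sup>- = 0\<close> when \<open>w < s\<close>.
\<close>

lemma solution_nonneg:
  assumes "solves s x b" and "0 < s" and "w < s" and b: "\<And>i. i < n \<Longrightarrow> 0 \<le> b i"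
    and "i < n"
  shows "0 \<le> x i"
proof -
  define y where "y j = max 0 (- x j)" for j
  have le: "s * y i \<le> (\<Sum>j<n. T i j * y j)" if i: "i < n" for i
  proof -
    have "0 \<le> (\<Sum>j<n. T i j * y j)"
      by (intro sum_nonneg mult_nonneg_nonneg) (auto simp: y_def i entry_nonneg)
    moreover have "s * - x i \<le> (\<Sum>j<n. T i j * y j)"
    proof -
      have "s * - x i \<le> (\<Sum>j<n. T i j * - x j)"
        using assms(1) b[OF i] i by (auto simp: solves_def sum_negf)
      also have "\<dots> \<le> (\<Sum>j<n. T i j * y j)"
        by (intro sum_mono mult_left_mono) (auto simp: y_def i entry_nonneg)
      finally show ?thesis .
    qed
    ultimately show ?thesis by (simp add: y_def max_def)
  qed
  have y0: "0 \<le> y j" for j by (simp add: y_def)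
  have "s * (\<Sum>i<n. y i) \<le> (\<Sum>i<n. \<Sum>j<n. T i j * y j)"
    unfolding sum_distrib_left by (intro sum_mono le) simp
  also have "\<dots> \<le> w * (\<Sum>i<n. y i)" by (rule sum_image_le) (rule y0)
  finally have "(s - w) * (\<Sum>i<n. y i) \<le> 0" by (simp add: algebra_simps)
  hence "(\<Sum>i<n. y i) \<le> 0" using \<open>w < s\<close> by (simp add: mult_le_0_iff)
  moreover have "y i \<le> (\<Sum>i<n. y i)"
    by (rule member_le_sum) (auto simp: y0 \<open>i < n\<close>)
  ultimately show ?thesis unfolding y_def by linarith
qed

lemma solution_sum_bounds:
  assumes x: "solves s x b" and s: "0 < s" "w < s" and b: "\<And>i. i < n \<Longrightarrow> 0 \<le> b i"
  shows "(s - w) * (\<Sum>i<n. x i) \<le> (\<Sum>i<n. b i)"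
    and "(\<Sum>i<n. b i) \<le> s * (\<Sum>i<n. x i)"
proof -
  have x0: "0 \<le> x i" if "i < n" for i by (rule solution_nonneg[OF x s b that])
  have eq: "s * (\<Sum>i<n. x i) = (\<Sum>i<n. \<Sum>j<n. T i j * x j) + (\<Sum>i<n. b i)"
    using x by (simp add: solves_def sum_distrib_left sum.distrib)
  show "(s - w) * (\<Sum>i<n. x i) \<le> (\<Sum>i<n. b i)"
    using eq sum_image_le[of x, OF x0] by (simp add: algebra_simps)
  have "0 \<le> (\<Sum>i<n. \<Sum>j<n. T i j * x j)"
    by (intro sum_nonneg mult_nonneg_nonneg) (auto simp: x0 entry_nonneg)
  thus "(\<Sum>i<n. b i) \<le> s * (\<Sum>i<n. x i)" using eq by simp
qed

text \<open>
  Resolvent identity: \<open>(t I - T) (y - x) = b - (t I - T) x = (s - t) x\<close>, a nonnegative right-hand side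
  when \<open>t \<le> s\<close>.
\<close>

lemma solution_difference_bounds:
  assumes x: "solves s x b" and y: "solves t y b" and t: "0 < t" "w < t" "t \<le> s"
    and b: "\<And>i. i < n \<Longrightarrow> 0 \<le> b i"
  shows "(t - w) * ((\<Sum>i<n. y i) - (\<Sum>i<n. x i)) \<le> (s - t) * (\<Sum>i<n. x i)"
    and "(s - t) * (\<Sum>i<n. x i) \<le> t * ((\<Sum>i<n. y i) - (\<Sum>i<n. x i))"
proof -
  have d: "solves t (\<lambda>i. y i - x i) (\<lambda>i. (s - t) * x i)"
    using x y by (simp add: solves_def sum_subtractf algebra_simps)
  have x0: "0 \<le> x i" if "i < n" for i using solution_nonneg[OF x _ _ b that] t by simp
  have r: "0 \<le> (s - t) * x i" if "i < n" for i using x0[OF that] t by simp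
  show "(t - w) * ((\<Sum>i<n. y i) - (\<Sum>i<n. x i)) \<le> (s - t) * (\<Sum>i<n. x i)"
    and "(s - t) * (\<Sum>i<n. x i) \<le> t * ((\<Sum>i<n. y i) - (\<Sum>i<n. x i))"
    using solution_sum_bounds[OF d t(1,2) r] by (simp_all add: sum_subtractf sum_distrib_left)
qed

text \<open>A kernel vector and its negative both solve the homogeneous equation, so both are nonnegative.\<close>

lemma homogeneous_solution_zero:
  assumes x: "solves s x (\<lambda>_. 0)" and s: "0 < s" "w < s" and i: "i < n"
  shows "x i = 0"
proof -
  have "solves s (\<lambda>i. - x i) (\<lambda>_. 0)" using x by (simp add: solves_def sum_negf)
  from solution_nonneg[OF this s _ i] solution_nonneg[OF x s _ i] show ?thesis by simp
qed

end

section \<open>Relaxed fixed-point iteration for a scalar map\<close>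

text \<open>
  The upper slope bound is below \<open>1\<close> and keeps the relaxed slope \<open>1 - \<tau> + \<tau> q\<close> below \<open>1\<close>.  The
  positive lower slope bound keeps it above \<open>-1\<close>, even for \<open>\<tau> = 2\<close>.
\<close>

lemma relaxed_map_contraction:
  fixes F :: "real \<Rightarrow> real"
  assumes q: "0 < p" "p \<le> q" "q < 1" and \<tau>: "0 < \<tau>" "\<tau> \<le> 2"
    and slope: "\<And>x y. x \<in> S \<Longrightarrow> y \<in> S \<Longrightarrow> x \<le> y \<Longrightarrow>
          p * (y - x) \<le> F y - F x \<and> F y - F x \<le> q * (y - x)"
  obtains c where "0 \<le> c" "c < 1"
    and "\<And>x y. x \<in> S \<Longrightarrow> y \<in> S \<Longrightarrow>
          dist (\<tau> * F x + (1 - \<tau>) * x) (\<tau> * F y + (1 - \<tau>) * y) \<le> c * dist x y"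
proof
  define c where "c = max (\<tau> - 1 - \<tau> * p) (1 - \<tau> + \<tau> * q)"
  let ?g = "\<lambda>x. \<tau> * F x + (1 - \<tau>) * x"
  have "\<tau> * p \<le> \<tau> * q" using q \<tau> by simp
  thus "0 \<le> c" unfolding c_def by linarith
  have "0 < \<tau> * p" "\<tau> * q < \<tau>" using q \<tau> by simp_all
  thus "c < 1" using \<tau> unfolding c_def by linarith
  have ordered: "\<bar>?g y - ?g x\<bar> \<le> c * (y - x)" if xy: "x \<in> S" "y \<in> S" "x \<le> y" for x y
  proof -
    have "\<tau> * (p * (y - x)) \<le> \<tau> * (F y - F x)" "\<tau> * (F y - F x) \<le> \<tau> * (q * (y - x))"
      using slope[OF xy] \<tau> by simp_all
    moreover have "(\<tau> - 1 - \<tau> * p) * (y - x) \<le> c * (y - x)"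
      "(1 - \<tau> + \<tau> * q) * (y - x) \<le> c * (y - x)"
      using xy by (auto intro!: mult_right_mono simp: c_def)
    ultimately show ?thesis by (simp add: abs_le_iff algebra_simps)
  qed
  show "dist (?g x) (?g y) \<le> c * dist x y" if "x \<in> S" "y \<in> S" for x y
  proof (cases "x \<le> y")
    case True
    thus ?thesis using ordered[OF that True] by (simp add: dist_real_def abs_minus_commute)
  next
    case False
    thus ?thesis using ordered[of y x] that by (simp add: dist_real_def)
  qed
qed

lemma contraction_iterates_converge:
  fixes g :: "'a::metric_space \<Rightarrow> 'a"
  assumes S: "complete S" "g ` S \<subseteq> S" and c: "0 \<le> c" "c < 1"
    and lip: "\<And>x y. x \<in> S \<Longrightarrow> y \<in> S \<Longrightarrow> dist (g x) (g y) \<le> c * dist x y"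
    and m: "m 0 \<in> S" "\<And>k. m (Suc k) = g (m k)"
  shows "\<exists>l\<in>S. m \<longlonglongrightarrow> l"
proof -
  from Banach_fix[OF S(1) _ c S(2)] lip m(1)
  obtain l where l: "l \<in> S" "g l = l" by blast
  have mS: "m k \<in> S" for k by (induction k) (use m S(2) in auto)
  have bound: "dist (m k) l \<le> c ^ k * dist (m 0) l" for k
  proof (induction k)
    case (Suc k)
    have "dist (m (Suc k)) l \<le> c * dist (m k) l"
      using lip[OF mS[of k] l(1)] l(2) m(2) by simp
    also have "\<dots> \<le> c * (c ^ k * dist (m 0) l)" using Suc c by (intro mult_left_mono)
    finally show ?case by simp
  qed simp
  have lim: "(\<lambda>k. c ^ k * dist (m 0) l) \<longlonglongrightarrow> 0"
    by (rule tendsto_mult_left_zero) (rule LIMSEQ_power_zero, use c in simp)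
  have "(\<lambda>k. dist (m k) l) \<longlonglongrightarrow> 0"
    by (rule tendsto_sandwich[OF _ _ tendsto_const lim]) (simp_all add: bound)
  hence "m \<longlonglongrightarrow> l" by (subst tendsto_dist_iff)
  thus ?thesis using l(1) by blast
qed

text \<open>
  Multiplying by the positive factor \<open>2\<beta> - m\<close> turns both bounds into polynomial inequalities, because
  \<open>F\<close> enters only through \<open>(2\<beta> - m) F m\<close>, which lies between \<open>\<beta> F \<beta>\<close> (by the slope estimate)
  and \<open>B\<close>.  They then follow from \<open>m (2\<beta> - m) = \<beta>\<^sup>2 - (\<beta> - m)\<^sup>2\<close>.
\<close>

lemma relaxed_map_self:
  fixes F :: "real \<Rightarrow> real"
  assumes \<beta>: "0 < \<beta>" and B: "B \<le> \<beta>\<^sup>2" and \<tau>: "0 < \<tau>" "\<tau> \<le> 2"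
    and end_point: "\<tau> * (\<beta> - F \<beta>) \<le> \<beta>"
    and m: "0 \<le> m" "m \<le> \<beta>"
    and F0: "0 \<le> F m" and up: "(2 * \<beta> - m) * F m \<le> B"
    and slope: "\<beta> * (F \<beta> - F m) \<le> (\<beta> - m) * F m"
  shows "\<tau> * F m + (1 - \<tau>) * m \<in> {0..\<beta>}"
proof -
  have pos: "0 < 2 * \<beta> - m" using \<beta> m by simp
  have "(2 * \<beta> - m) * (\<tau> * F m + (1 - \<tau>) * m - \<beta>)
      = \<tau> * ((2 * \<beta> - m) * F m) - \<tau> * \<beta>\<^sup>2 + (\<beta> - m) * ((\<tau> - 1) * (\<beta> - m) - \<beta>)"
    by (simp add: algebra_simps power2_eq_square)
  also have "\<dots> \<le> 0"
  proof -
    have "\<tau> * ((2 * \<beta> - m) * F m) \<le> \<tau> * \<beta>\<^sup>2" using up B \<tau> by simp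
    moreover have "(\<tau> - 1) * (\<beta> - m) \<le> 1 * (\<beta> - m)" using m \<tau> by (intro mult_right_mono) auto
    hence "(\<beta> - m) * ((\<tau> - 1) * (\<beta> - m) - \<beta>) \<le> 0"
      using m by (intro mult_nonneg_nonpos) auto
    ultimately show ?thesis by linarith
  qed
  finally have le: "\<tau> * F m + (1 - \<tau>) * m \<le> \<beta>" using pos by (simp add: mult_le_0_iff)
  have ge: "0 \<le> \<tau> * F m + (1 - \<tau>) * m"
  proof (cases "\<tau> \<le> 1")
    case True
    thus ?thesis using F0 m \<tau> by simp
  next
    case False
    have "m * (2 * \<beta> - m) \<le> \<beta> * \<beta>"
      using zero_le_square[of "\<beta> - m"] by (simp add: algebra_simps)
    hence "(\<tau> - 1) * (m * (2 * \<beta> - m)) \<le> (\<tau> - 1) * (\<beta> * \<beta>)" using False by simp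
    moreover have "\<beta> * ((\<tau> - 1) * \<beta>) \<le> \<beta> * (\<tau> * F \<beta>)"
      using end_point \<beta> by (intro mult_left_mono) (auto simp: algebra_simps)
    moreover have "\<tau> * (\<beta> * F \<beta>) \<le> \<tau> * ((2 * \<beta> - m) * F m)"
      using slope \<tau> by (intro mult_left_mono) (auto simp: algebra_simps)
    ultimately have "0 \<le> (2 * \<beta> - m) * (\<tau> * F m + (1 - \<tau>) * m)"
      by (simp add: algebra_simps)
    thus ?thesis using pos by (simp add: zero_le_mult_iff)
  qed
  from le ge show ?thesis by simp
qed

text \<open>
  The hypotheses are exactly the estimates that the shifted linear systems provide for the 1-norm of
  their solutions, with shift \<open>s = 1 + \<beta> - x\<close> and \<open>s - w = 2\<beta> - x\<close>.  Dividing by the factors,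
  which satisfy \<open>2\<beta> - x \<ge> \<beta>\<close> and \<open>1 + \<beta> - x \<le> 2\<close>, bounds the secant slopes by \<open>B / \<beta>\<^sup>2\<close>
  and \<open>B / 4\<close>.
\<close>

lemma relaxed_iteration_converges:
  fixes F :: "real \<Rightarrow> real"
  assumes \<beta>: "0 < \<beta>" "\<beta> \<le> 1" and B: "0 < B" "B < \<beta>\<^sup>2" and \<tau>: "0 < \<tau>" "\<tau> \<le> 2"
    and end_point: "\<tau> * (\<beta> - F \<beta>) \<le> \<beta>"
    and up: "\<And>x. x \<in> {0..\<beta>} \<Longrightarrow> (2 * \<beta> - x) * F x \<le> B"
    and low: "\<And>x. x \<in> {0..\<beta>} \<Longrightarrow> B \<le> (1 + \<beta> - x) * F x"
    and slope_up: "\<And>x y. x \<in> {0..\<beta>} \<Longrightarrow> y \<in> {0..\<beta>} \<Longrightarrow> x \<le> y \<Longrightarrow>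
        (2 * \<beta> - y) * (F y - F x) \<le> (y - x) * F x"
    and slope_low: "\<And>x y. x \<in> {0..\<beta>} \<Longrightarrow> y \<in> {0..\<beta>} \<Longrightarrow> x \<le> y \<Longrightarrow>
        (y - x) * F x \<le> (1 + \<beta> - y) * (F y - F x)"
    and m: "m 0 \<in> {0..\<beta>}" "\<And>k. m (Suc k) = \<tau> * F (m k) + (1 - \<tau>) * m k"
  shows "\<exists>l\<in>{0..\<beta>}. m \<longlonglongrightarrow> l"
proof -
  have F0: "0 \<le> F x" if "x \<in> {0..\<beta>}" for x
  proof -
    have "0 < (1 + \<beta> - x) * F x" using low[OF that] B by linarith
    thus ?thesis using that by (auto simp: zero_less_mult_iff)
  qed
  have slope: "B / 4 * (y - x) \<le> F y - F x \<and> F y - F x \<le> B / \<beta>\<^sup>2 * (y - x)"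
    if xy: "x \<in> {0..\<beta>}" "y \<in> {0..\<beta>}" "x \<le> y" for x y
  proof -
    have "0 \<le> (1 + \<beta> - y) * (F y - F x)"
      using slope_low[OF xy] F0[OF xy(1)] xy(3) by (meson diff_ge_0_iff_ge mult_nonneg_nonneg order_trans)
    hence mono: "0 \<le> F y - F x" using xy by (auto simp: zero_le_mult_iff)
    have "(1 + \<beta> - x) * F x \<le> 2 * F x" using xy \<beta> F0[OF xy(1)] by (intro mult_right_mono) auto
    hence "B / 2 \<le> F x" using low[OF xy(1)] by linarith
    hence "(y - x) * (B / 2) \<le> (y - x) * F x" using xy by (intro mult_left_mono) auto
    also have "\<dots> \<le> (1 + \<beta> - y) * (F y - F x)" by (rule slope_low[OF xy])
    also have "\<dots> \<le> 2 * (F y - F x)" using mono xy \<beta> by (intro mult_right_mono) auto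
    finally have lower: "B / 4 * (y - x) \<le> F y - F x" by (simp add: algebra_simps)
    have "\<beta> * F x \<le> (2 * \<beta> - x) * F x" using xy F0[OF xy(1)] by (intro mult_right_mono) auto
    hence Fx: "\<beta> * F x \<le> B" using up[OF xy(1)] by linarith
    have "\<beta> * (F y - F x) \<le> (2 * \<beta> - y) * (F y - F x)" using mono xy by (intro mult_right_mono) auto
    also have "\<dots> \<le> (y - x) * F x" by (rule slope_up[OF xy])
    finally have "\<beta> * (\<beta> * (F y - F x)) \<le> \<beta> * ((y - x) * F x)" using \<beta> by simp
    also have "\<dots> = (y - x) * (\<beta> * F x)" by simp
    also have "\<dots> \<le> (y - x) * B" using Fx xy by (intro mult_left_mono) auto
    finally have "F y - F x \<le> B / \<beta>\<^sup>2 * (y - x)"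
      using \<beta> by (simp add: field_simps power2_eq_square)
    with lower show ?thesis by blast
  qed
  have pq: "0 < B / 4" "B / 4 \<le> B / \<beta>\<^sup>2" "B / \<beta>\<^sup>2 < 1"
  proof -
    have "\<beta>\<^sup>2 \<le> 1" using \<beta> by (simp add: power_le_one)
    thus "B / 4 \<le> B / \<beta>\<^sup>2" using B \<beta> by (intro divide_left_mono) auto
  qed (use B \<beta> in \<open>simp_all add: divide_less_eq\<close>)
  obtain c where c: "0 \<le> c" "c < 1"
    "\<And>x y. x \<in> {0..\<beta>} \<Longrightarrow> y \<in> {0..\<beta>} \<Longrightarrow>
          dist (\<tau> * F x + (1 - \<tau>) * x) (\<tau> * F y + (1 - \<tau>) * y) \<le> c * dist x y"
    using relaxed_map_contraction[where F = F and S = "{0..\<beta>}", OF pq \<tau> slope] by blast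
  have self: "\<tau> * F x + (1 - \<tau>) * x \<in> {0..\<beta>}" if x: "x \<in> {0..\<beta>}" for x
  proof (rule relaxed_map_self[where F = F and B = B, OF \<beta>(1) _ \<tau> end_point])
    show "\<beta> * (F \<beta> - F x) \<le> (\<beta> - x) * F x" using slope_up[OF x, of \<beta>] x by simp
    show "(2 * \<beta> - x) * F x \<le> B" "0 \<le> F x" using up[OF x] F0[OF x] by simp_all
  qed (use B(2) x in simp_all)
  show ?thesis
  proof (rule contraction_iterates_converge[where g = "\<lambda>x. \<tau> * F x + (1 - \<tau>) * x" and c = c])
    show "complete {0..\<beta>}" by (simp add: compact_imp_complete)
    show "(\<lambda>x. \<tau> * F x + (1 - \<tau>) * x) ` {0..\<beta>} \<subseteq> {0..\<beta>}" using self by blast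
  qed (fact c m)+
qed

section \<open>Toeplitz systems\<close>

lemma mat_inv_mult_vec:
  assumes M: "M \<in> carrier_mat n n" and b: "b \<in> carrier_vec n"
    and ker: "\<And>v. v \<in> carrier_vec n \<Longrightarrow> M *\<^sub>v v = 0\<^sub>v n \<Longrightarrow> v = 0\<^sub>v n"
  shows "mat_inv M *\<^sub>v b \<in> carrier_vec n" and "M *\<^sub>v (mat_inv M *\<^sub>v b) = b"
proof -
  have "det M \<noteq> 0" using det_0_iff_vec_prod_zero[OF M] ker by blast
  hence "M \<in> Units (ring_mat TYPE(real) n ())" by (rule det_non_zero_imp_unit[OF M])
  hence "mat_inverse M \<noteq> None" using mat_inverse(1)[OF M, of "()"] by blast
  then obtain N where "mat_inverse M = Some N" by blast
  hence N: "M * mat_inv M = 1\<^sub>m n" "mat_inv M \<in> carrier_mat n n"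
    using mat_inverse(2)[OF M] by (auto simp: mat_inv_def)
  show "mat_inv M *\<^sub>v b \<in> carrier_vec n" using N b by simp
  show "M *\<^sub>v (mat_inv M *\<^sub>v b) = b"
    using assoc_mult_mat_vec[OF M N(2) b] N(1) b by simp
qed

text \<open>
  The entries of a column are \<open>a (j - i)\<close> for distinct indices in the range of the Wiener norm.
\<close>

lemma toeplitz_column_sum_le:
  assumes j: "j < n"
  shows "(\<Sum>i<n. a (int j - int i)) \<le> wiener_norm n a"
proof -
  have "(\<Sum>i<n. a (int j - int i)) \<le> (\<Sum>i<n. \<bar>a (int j - int i)\<bar>)" by (intro sum_mono) simp
  also have "\<dots> = (\<Sum>k\<in>(\<lambda>i. int j - int i) ` {..<n}. \<bar>a k\<bar>)"
    by (subst sum.reindex) (auto simp: inj_on_def)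
  also have "\<dots> \<le> wiener_norm n a"
    unfolding wiener_norm_def by (intro sum_mono2) (use j in auto)
  finally show ?thesis .
qed

lemma shifted_toeplitz_mult_index:
  assumes "v \<in> carrier_vec n" and "i < n"
  shows "((r \<cdot>\<^sub>m 1\<^sub>m n - toeplitz n a - \<mu> \<cdot>\<^sub>m 1\<^sub>m n) *\<^sub>v v) $ i
    = (r - \<mu>) * v $ i - (\<Sum>j<n. a (int j - int i) * v $ j)"
proof -
  have "((r \<cdot>\<^sub>m 1\<^sub>m n - toeplitz n a - \<mu> \<cdot>\<^sub>m 1\<^sub>m n) *\<^sub>v v) $ i
    = (\<Sum>j<n. (r - \<mu>) * (if i = j then v $ j else 0) - a (int j - int i) * v $ j)"
    using assms by (auto simp: toeplitz_def scalar_prod_def lessThan_atLeast0 algebra_simps intro!: sum.cong)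
  also have "\<dots> = (r - \<mu>) * (\<Sum>j<n. if i = j then v $ j else 0) - (\<Sum>j<n. a (int j - int i) * v $ j)"
    by (simp only: sum_subtractf sum_distrib_left)
  finally show ?thesis using assms by simp
qed

theorem lemma3p2:
  fixes n :: nat
    and a :: "int \<Rightarrow> real"
    and A :: "real mat"
    and b :: "real vec"
    and \<beta> \<tau> \<mu>\<^sub>0 :: real
    and x :: "nat \<Rightarrow> real vec"
    and \<mu> :: "nat \<Rightarrow> real"
  assumes "n \<ge> 1"
    and A_def: "A = (2 - wiener_norm n a) \<cdot>\<^sub>m 1\<^sub>m n - toeplitz n a"
    and beta_def: "\<beta> = 1 - wiener_norm n a"
    and "b \<in> carrier_vec n" and "0\<^sub>v n \<le> b" and "b \<noteq> 0\<^sub>v n"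
    and "0\<^sub>m n n \<le> toeplitz n a"
    and "wiener_norm n a + vec_norm1 b < 1"
    and "vec_norm1 b < (1 - wiener_norm n a)\<^sup>2"
    and "0 < \<tau>"
    and "\<tau> \<le> Min {2, \<beta> / vec_norm1 (mat_inv A *\<^sub>v b),
                    \<beta> / (\<beta> - vec_norm1 (mat_inv (A - \<beta> \<cdot>\<^sub>m 1\<^sub>m n) *\<^sub>v b))}"
    and "\<mu>\<^sub>0 \<in> {0..\<beta>}"
    and "\<mu> 0 = \<mu>\<^sub>0"
    and "\<And>k. x (Suc k) = mat_inv (A - \<mu> k \<cdot>\<^sub>m 1\<^sub>m n) *\<^sub>v b"
    and "\<And>k. \<mu> (Suc k) = \<tau> * vec_norm1 (x (Suc k)) + (1 - \<tau>) * \<mu> k"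
  shows "\<exists>\<mu>\<^sub>s \<in> {0..\<beta>}. \<mu> \<longlonglongrightarrow> \<mu>\<^sub>s"
proof -
  define w where "w = wiener_norm n a"
  define B where "B = vec_norm1 b"
  define y where "y m = mat_inv (A - m \<cdot>\<^sub>m 1\<^sub>m n) *\<^sub>v b" for m
  define F where "F m = vec_norm1 (y m)" for m
  have b: "b \<in> carrier_vec n" and b0: "\<And>i. i < n \<Longrightarrow> 0 \<le> b $ i"
    using assms(4,5) by (auto simp: less_eq_vec_def)
  interpret column_bounded n "\<lambda>i j. a (int j - int i)" w
    using assms(7) toeplitz_column_sum_le
    by unfold_locales (auto simp: w_def toeplitz_def less_eq_mat_def)
  have B_sum: "B = (\<Sum>i<n. b $ i)"
    using b b0 by (auto simp: B_def vec_norm1_def intro!: sum.cong)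
  have B_pos: "0 < B"
  proof -
    obtain i where i: "i < n" "b $ i \<noteq> 0" using assms(6) b by (metis eq_vecI carrier_vecD index_zero_vec)
    have "b $ i \<le> B" unfolding B_sum by (rule member_le_sum) (use i b0 in auto)
    thus ?thesis using b0[OF i(1)] i(2) by simp
  qed
  have w0: "0 \<le> w" by (simp add: w_def wiener_norm_def sum_nonneg)
  have \<beta>: "0 < \<beta>" "\<beta> \<le> 1"
    using assms(8) B_pos w0 by (auto simp: beta_def w_def B_def)
  have B_less: "B < \<beta>\<^sup>2" using assms(9) by (simp add: B_def beta_def)
  have w_eq: "w = 1 - \<beta>" by (simp add: beta_def w_def)
  have shift: "0 < 1 + \<beta> - m" "w < 1 + \<beta> - m" if "m \<in> {0..\<beta>}" for m
    using that \<beta> by (auto simp: w_eq)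
  have system: "((A - m \<cdot>\<^sub>m 1\<^sub>m n) *\<^sub>v v) $ i
      = (1 + \<beta> - m) * v $ i - (\<Sum>j<n. a (int j - int i) * v $ j)"
    if "v \<in> carrier_vec n" "i < n" for m v i
    using shifted_toeplitz_mult_index[OF that, of "2 - wiener_norm n a" a m]
    by (simp add: A_def beta_def)
  have A_carrier: "A - m \<cdot>\<^sub>m 1\<^sub>m n \<in> carrier_mat n n" for m
    by (auto simp: A_def toeplitz_def)
  have y_carrier: "y m \<in> carrier_vec n" and y_solves: "solves (1 + \<beta> - m) (\<lambda>i. y m $ i) (\<lambda>i. b $ i)"
    if m: "m \<in> {0..\<beta>}" for m
  proof -
    have ker: "v = 0\<^sub>v n" if v: "v \<in> carrier_vec n" "(A - m \<cdot>\<^sub>m 1\<^sub>m n) *\<^sub>v v = 0\<^sub>v n" for v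
    proof -
      have "solves (1 + \<beta> - m) (\<lambda>i. v $ i) (\<lambda>_. 0)"
        unfolding solves_def using system[OF v(1), of _ m] v(2) by simp
      from homogeneous_solution_zero[OF this shift[OF m]] v(1)
      show ?thesis by (intro eq_vecI) auto
    qed
    note inv = mat_inv_mult_vec[OF A_carrier b ker, of m, folded y_def]
    show y: "y m \<in> carrier_vec n" by (rule inv)
    show "solves (1 + \<beta> - m) (\<lambda>i. y m $ i) (\<lambda>i. b $ i)"
      unfolding solves_def using system[OF y, of _ m] inv(2) by simp
  qed
  have F_sum: "F m = (\<Sum>i<n. y m $ i)" if m: "m \<in> {0..\<beta>}" for m
    using y_carrier[OF m] solution_nonneg[OF y_solves[OF m] shift[OF m] b0]
    by (auto simp: F_def vec_norm1_def intro!: sum.cong)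
  have sum_bounds: "(2 * \<beta> - m) * F m \<le> B" "B \<le> (1 + \<beta> - m) * F m" if m: "m \<in> {0..\<beta>}" for m
    using solution_sum_bounds[OF y_solves[OF m] shift[OF m] b0]
    by (simp_all add: F_sum[OF m] B_sum w_eq algebra_simps)
  have diff_bounds: "(2 * \<beta> - m') * (F m' - F m) \<le> (m' - m) * F m"
    "(m' - m) * F m \<le> (1 + \<beta> - m') * (F m' - F m)"
    if m: "m \<in> {0..\<beta>}" "m' \<in> {0..\<beta>}" "m \<le> m'" for m m'
    using solution_difference_bounds[OF y_solves[OF m(1)] y_solves[OF m(2)] shift[OF m(2)] _ b0] m(3)
    by (simp_all add: F_sum[OF m(1)] F_sum[OF m(2)] w_eq algebra_simps)
  have \<tau>: "\<tau> \<le> 2" "\<tau> \<le> \<beta> / (\<beta> - F \<beta>)" using assms(11) by (auto simp: F_def y_def)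
  have "\<beta> * F \<beta> \<le> B" using sum_bounds(1)[of \<beta>] \<beta> by simp
  hence "\<beta> * F \<beta> < \<beta> * \<beta>" using B_less unfolding power2_eq_square by (rule le_less_trans)
  hence "0 < \<beta> - F \<beta>" using \<beta> by simp
  hence end_point: "\<tau> * (\<beta> - F \<beta>) \<le> \<beta>" using \<tau>(2) by (simp add: le_divide_eq)
  have step: "\<mu> (Suc k) = \<tau> * F (\<mu> k) + (1 - \<tau>) * \<mu> k" for k
    using assms(14,15) by (simp add: F_def y_def)
  have start: "\<mu> 0 \<in> {0..\<beta>}" using assms(12,13) by simp
  show ?thesis
  proof (rule relaxed_iteration_converges[where F = F, OF \<beta> B_pos B_less assms(10) \<tau>(1) end_point])
    fix m m' assume "m \<in> {0..\<beta>}" "m' \<in> {0..\<beta>}" "m \<le> m'"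
    thus "(2 * \<beta> - m') * (F m' - F m) \<le> (m' - m) * F m"
      and "(m' - m) * F m \<le> (1 + \<beta> - m') * (F m' - F m)"
      by (rule diff_bounds)+
  qed (fact sum_bounds start step)+
qed

end
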